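(* Let $p\in[1,2]$ and let $\alpha>1$ be a positive integer. For every positive integer $j$, let $$A_{j}:=\left[\tfrac12+\sqrt{\tfrac14+\log_{\alpha}\left(\tfrac{j+1}{2}\right)},\ \tfrac12+\sqrt{\tfrac14+\log_{\alpha}j}\right]\cap\mathbb{N}.$$ Each $A_j$ contains at most one element. Define the sequence $(x^{(j)})_{j=1}^{\infty}$ in the complex space $\ell_p$ by $$x^{(j)}=\alpha^{\frac{(1-k_{j})(k_{j}(2+p)+2p)}{2p}}\cdot\sum_{s=1}^{\alpha^{k_{j}(k_{j}-1)}}\exp\left(\left[j\alpha^{k_{j}(1-k_{j})}+\alpha^{k_{j}(1-k_{j})}-1\right]2\pi s i\right)\, e_{\alpha^{k_{j}(k_{j}-1)}+s-1}$$ if $A_{j}\neq\emptyset$, where $k_{j}$ is the unique element of $A_{j}$, and $x^{(j)}=0$ if $A_j=\emptyset$. Then $(x^{(j)})_{j=1}^{\infty}$ is unconditionally summable in $\ell_{p}$ (over the complex scalar field) and $$\sum_{j=1}^{\infty}\left\Vert x^{(j)}\right\Vert^{2-\varepsilon}=\infty$$ for all $\varepsilon>0$.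
   Context: $\mathbb{N}$ denotes the positive integers and $i$ the imaginary unit. $\ell_p$ is the Banach space of $p$-summable complex sequences indexed by the positive integers, with its usual norm $\Vert\cdot\Vert$, and $(e_m)_{m=1}^\infty$ are its canonical unit vectors. A sequence $(x^{(j)})_{j=1}^\infty$ in a Banach space is unconditionally summable if the series $\sum_j x^{(j)}$ is unconditionally convergent, i.e. all rearrangements of the series converge (to the same vector). In the sum $\sum_j\Vert x^{(j)}\Vert^{2-\varepsilon}$, the indices $j$ with $x^{(j)}=0$ contribute $0$ (this convention matters only for $\varepsilon\ge 2$). *)

theory Defs
  imports "HOL-Analysis.Analysis"
begin

text \<open>
  Sequences indexed by the positive integers are functions on \<open>nat\<close> that are only used on
  \<open>{1..}\<close>. For elements of \<open>ellp p\<close> the unused value at \<open>0\<close> is required to be \<open>0\<close>, so that equality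
  of functions is equality of sequences. The exponent is a real number \<open>p \<ge> 1\<close>.
\<close>

definition ellp :: "real \<Rightarrow> (nat \<Rightarrow> complex) set" where
  "ellp p = {x. x 0 = 0 \<and> (\<lambda>m. norm (x m) powr p) summable_on {1..}}"

definition ellp_norm :: "real \<Rightarrow> (nat \<Rightarrow> complex) \<Rightarrow> real" where
  "ellp_norm p x = (\<Sum>\<^sub>\<infinity>m\<in>{1..}. norm (x m) powr p) powr (1 / p)"

definition unit_vec :: "nat \<Rightarrow> nat \<Rightarrow> complex" where
  "unit_vec n = (\<lambda>m. if m = n then 1 else 0)"

definition ellp_sums :: "real \<Rightarrow> (nat \<Rightarrow> nat \<Rightarrow> complex) \<Rightarrow> (nat \<Rightarrow> complex) \<Rightarrow> bool" where
  "ellp_sums p y v \<longleftrightarrow>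
     (\<forall>j\<ge>1. y j \<in> ellp p) \<and> v \<in> ellp p \<and>
     (\<lambda>n. ellp_norm p (\<lambda>m. (\<Sum>j=1..n. y j m) - v m)) \<longlonglongrightarrow> 0"

definition ellp_unconditionally_summable :: "real \<Rightarrow> (nat \<Rightarrow> nat \<Rightarrow> complex) \<Rightarrow> bool" where
  "ellp_unconditionally_summable p y \<longleftrightarrow>
     (\<exists>v. \<forall>\<pi>. bij_betw \<pi> {1..} {1..} \<longrightarrow> ellp_sums p (\<lambda>j. y (\<pi> j)) v)"

definition A_set :: "nat \<Rightarrow> nat \<Rightarrow> nat set" where
  "A_set \<alpha> j = {k. k \<ge> 1 \<and>
     real k \<in> {1/2 + sqrt (1/4 + log (real \<alpha>) ((real j + 1) / 2)) ..
               1/2 + sqrt (1/4 + log (real \<alpha>) (real j))}}"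

text \<open>
  The definite description is meaningful because \<open>A_set \<alpha> j\<close> has at most one element for \<open>\<alpha> > 1\<close> and
  \<open>j \<ge> 1\<close>. Since elements of \<open>A_set \<alpha> j\<close> are positive, the truncated subtractions \<open>k - 1\<close> and
  \<open>\<alpha> ^ (k * (k - 1)) + s - 1\<close> on \<open>nat\<close> agree with the integer ones.
\<close>

definition xseq :: "real \<Rightarrow> nat \<Rightarrow> nat \<Rightarrow> nat \<Rightarrow> complex" where
  "xseq p \<alpha> j =
     (if A_set \<alpha> j = {} then (\<lambda>m. 0)
      else let k = (THE k. k \<in> A_set \<alpha> j) in
        (\<lambda>m. complex_of_real
               (real \<alpha> powr ((1 - real k) * (real k * (2 + p) + 2 * p) / (2 * p))) *
             (\<Sum>s = 1..\<alpha> ^ (k * (k - 1)).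
                exp (complex_of_real
                       (real j * real \<alpha> powr (real k * (1 - real k))
                        + real \<alpha> powr (real k * (1 - real k)) - 1)
                     * 2 * complex_of_real pi * of_nat s * \<i>)
                * unit_vec (\<alpha> ^ (k * (k - 1)) + s - 1) m)))"

end

theory Submission
  imports Defs "HOL-Real_Asymp.Real_Asymp"
begin

text \<open>
  Put \<open>N = \<alpha> ^ (k * (k - 1))\<close>. The nonzero \<open>x\<^sup>(\<^sup>j\<^sup>)\<close> are those with \<open>N \<le> j < 2 * N\<close> for some \<open>k\<close>;
  they are supported on the same (disjoint) blocks and are there the rows of an \<open>N \<times> N\<close> Fourier
  matrix times \<open>N powr (- 1 / p - 1 / 2) * \<alpha> powr (1 - k)\<close>. By Parseval and the comparison of the
  \<open>p\<close>-norm with the 2-norm, the sum of any subfamily of a block has \<open>p\<close>-norm at most \<open>\<alpha> powr (1 - k)\<close>.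
  This is summable in \<open>k\<close>, so the sum over any family avoiding the first blocks is small. In contrast,
  a block contributes \<open>N powr (\<epsilon> / 2) * \<alpha> powr ((1 - k) * (2 - \<epsilon>))\<close> to the series of norms, and this
  tends to infinity because \<open>N\<close> is exponential in \<open>k\<^sup>2\<close>.
\<close>

section \<open>Roots of unity and comparison of power sums\<close>

lemma sum_powers_root_of_unity:
  fixes w :: complex
  assumes "w ^ N = 1"
  shows "(\<Sum>s=1..N. w ^ s) = (if w = 1 then of_nat N else 0)"
proof (cases "w = 1")
  case False
  have "(\<Sum>s=1..N. w ^ s) = w * (\<Sum>s<N. w ^ s)"
    by (simp add: sum.atLeast1_atMost_eq sum_distrib_left)
  also have "(\<Sum>s<N. w ^ s) = 0"
    using False assms by (simp add: geometric_sum)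
  finally show ?thesis using False by simp
qed simp

text \<open>The vectors of powers of distinct \<open>N\<close>-th roots of unity are orthogonal, so
  after expanding the square only the diagonal survives and each root contributes
  \<open>N\<close>.\<close>

lemma parseval_roots_of_unity:
  fixes z :: "'a \<Rightarrow> complex"
  assumes "finite I" "inj_on z I" "\<And>i. i \<in> I \<Longrightarrow> z i ^ N = 1" "N > 0"
  shows "(\<Sum>s=1..N. (norm (\<Sum>i\<in>I. z i ^ s))\<^sup>2) = real N * real (card I)"
proof -
  have ortho: "(\<Sum>s=1..N. z i ^ s * cnj (z i') ^ s) = (if i = i' then of_nat N else 0)"
    if "i \<in> I" "i' \<in> I" for i i'
  proof -
    have n1: "norm (z i') = 1"
      using assms(3)[OF that(2)] \<open>N > 0\<close>
      by (metis norm_ge_zero norm_one norm_power power_eq_1_iff not_gr_zero)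
    hence c: "z i' * cnj (z i') = 1" using complex_norm_square[of "z i'"] by simp
    \<comment> \<open>On the unit circle conjugation is inversion, so this product is the quotient
      of the two roots, again an \<open>N\<close>-th root of unity.\<close>
    have "z i * cnj (z i') = 1 \<longleftrightarrow> z i = z i'"
      using c by (metis mult.assoc mult.commute mult_1)
    hence "z i * cnj (z i') = 1 \<longleftrightarrow> i = i'"
      using assms(2) that by (auto simp: inj_on_def)
    moreover have "(z i * cnj (z i')) ^ N = 1"
      using assms(3)[OF that(1)] assms(3)[OF that(2)]
      by (simp add: power_mult_distrib flip: complex_cnj_power)
    ultimately show ?thesis
      using sum_powers_root_of_unity[of "z i * cnj (z i')" N] by (simp add: power_mult_distrib)
  qed
  have "complex_of_real (\<Sum>s=1..N. (norm (\<Sum>i\<in>I. z i ^ s))\<^sup>2) =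
        (\<Sum>s=1..N. \<Sum>i\<in>I. \<Sum>i'\<in>I. z i ^ s * cnj (z i') ^ s)"
    by (simp add: complex_norm_square sum_product del: of_real_power)
  also have "\<dots> = (\<Sum>i\<in>I. \<Sum>i'\<in>I. \<Sum>s=1..N. z i ^ s * cnj (z i') ^ s)"
    by (subst sum.swap, intro sum.cong refl sum.swap)
  also have "\<dots> = (\<Sum>i\<in>I. \<Sum>i'\<in>I. if i = i' then of_nat N else 0)"
    using ortho by (intro sum.cong refl) auto
  also have "\<dots> = complex_of_real (real N * real (card I))"
    using assms(1) by (simp add: mult.commute)
  finally show ?thesis by (simp only: of_real_eq_iff)
qed

text \<open>This is the power mean inequality for the exponents \<open>p\<close> and 2, with
  \<open>l\<close> bounding the mean square. Young's inequality for \<open>(f i)\<^sup>2\<close> and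
  \<open>l\<close> with weights \<open>p / 2\<close> and \<open>1 - p / 2\<close> bounds each term
  linearly in the square, which can be summed.\<close>

lemma sum_powr_le_of_sum_squares_le:
  fixes f :: "'a \<Rightarrow> real"
  assumes p: "0 < p" "p \<le> 2" and l: "l > 0" and nonneg: "\<And>i. i \<in> A \<Longrightarrow> f i \<ge> 0"
    and le: "(\<Sum>i\<in>A. (f i)\<^sup>2) \<le> real (card A) * l"
  shows "(\<Sum>i\<in>A. f i powr p) \<le> real (card A) * l powr (p / 2)"
proof -
  have "f i powr p * l powr (1 - p / 2) \<le> p / 2 * (f i)\<^sup>2 + (1 - p / 2) * l" if "i \<in> A" for i
  proof (cases "f i = 0")
    case True
    thus ?thesis using p l by simp
  next
    case False
    hence "f i > 0" using nonneg[OF that] by simp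
    moreover from this have "((f i)\<^sup>2) powr (p / 2) = f i powr p"
      by (simp add: powr_powr flip: powr_numeral)
    ultimately show ?thesis
      using Youngs_inequality_0[of "p/2" "1 - p/2" "(f i)\<^sup>2" l] p l by simp
  qed
  hence "(\<Sum>i\<in>A. f i powr p) * l powr (1 - p / 2)
      \<le> (\<Sum>i\<in>A. p / 2 * (f i)\<^sup>2 + (1 - p / 2) * l)"
    by (simp add: sum_distrib_right sum_mono)
  also have "\<dots> = p / 2 * (\<Sum>i\<in>A. (f i)\<^sup>2) + (1 - p / 2) * (real (card A) * l)"
    by (simp add: sum.distrib sum_distrib_left)
  also have "\<dots> \<le> p / 2 * (real (card A) * l) + (1 - p / 2) * (real (card A) * l)"
    using le p by (intro add_right_mono mult_left_mono) auto
  also have "\<dots> = real (card A) * l powr (p / 2) * l powr (1 - p / 2)"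
    using l by (simp add: algebra_simps flip: powr_add)
  finally show ?thesis using l by simp
qed

section \<open>Blocks of indices\<close>

definition blen :: "nat \<Rightarrow> nat \<Rightarrow> nat" where
  "blen \<alpha> k = \<alpha> ^ (k * (k - 1))"

definition block :: "nat \<Rightarrow> nat \<Rightarrow> nat set" where
  "block \<alpha> k = {blen \<alpha> k..<2 * blen \<alpha> k}"

lemma finite_block [simp]: "finite (block \<alpha> k)"
  and card_block [simp]: "card (block \<alpha> k) = blen \<alpha> k"
  by (simp_all add: block_def)

lemma blen_pos: "\<alpha> > 1 \<Longrightarrow> blen \<alpha> k > 0"
  by (simp add: blen_def)

lemma blen_mono:
  assumes "\<alpha> > 1" "k \<le> k'"
  shows "blen \<alpha> k \<le> blen \<alpha> k'"
  unfolding blen_def using assms by (intro power_increasing mult_le_mono diff_le_mono) auto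

text \<open>The exponent grows by \<open>2 * k\<close>, hence the length by a factor of at least
  \<open>\<alpha> \<ge> 2\<close>. For \<open>k = 0\<close> this fails:
  \<open>block \<alpha> 0\<close> and \<open>block \<alpha> 1\<close> are both \<open>{1}\<close>,
  so disjointness of blocks is only available from index 1 on.\<close>

lemma blen_Suc:
  assumes "\<alpha> > 1" "k \<ge> 1"
  shows "2 * blen \<alpha> k \<le> blen \<alpha> (Suc k)"
proof -
  have "Suc (k * (k - 1)) \<le> Suc k * (Suc k - 1)"
    using assms(2) by (cases k) auto
  hence "\<alpha> ^ Suc (k * (k - 1)) \<le> blen \<alpha> (Suc k)"
    unfolding blen_def using assms(1) by (intro power_increasing) auto
  moreover have "2 * blen \<alpha> k \<le> \<alpha> ^ Suc (k * (k - 1))"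
    unfolding blen_def using assms(1) by simp
  ultimately show ?thesis by linarith
qed

lemma block_unique:
  assumes "\<alpha> > 1" "k \<ge> 1" "k' \<ge> 1" "j \<in> block \<alpha> k" "j \<in> block \<alpha> k'"
  shows "k = k'"
proof -
  have *: False if "l < l'" "l \<ge> 1" "j \<in> block \<alpha> l" "j \<in> block \<alpha> l'" for l l'
    using blen_Suc[OF assms(1) that(2)] blen_mono[OF assms(1), of "Suc l" l'] that
    by (auto simp: block_def)
  show ?thesis using *[of k k'] *[of k' k] assms by (metis nat_neq_iff)
qed

text \<open>A crude bound, used to see that finitely many coordinates meet only finitely many
  blocks.\<close>

lemma le_blen:
  assumes "\<alpha> > 1"
  shows "k \<le> blen \<alpha> k"
proof -
  have "k \<le> 2 ^ (k - 1)" 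
    by (cases k) (auto simp: Suc_le_eq less_exp)
  also have "\<dots> \<le> \<alpha> ^ (k - 1)" using assms by (intro power_mono) auto
  also have "\<dots> \<le> blen \<alpha> k"
    unfolding blen_def using assms by (cases k) (auto intro!: power_increasing)
  finally show ?thesis .
qed

text \<open>Since \<open>(k - 1/2)\<^sup>2 = 1/4 + k * (k - 1)\<close>, subtracting 1/2, squaring
  and exponentiating turn the two bounds on \<open>k\<close> into
  \<open>(j + 1) / 2 \<le> blen \<alpha> k \<le> j\<close>.\<close>

lemma A_set_eq:
  assumes "\<alpha> > 1" "j \<ge> 1"
  shows "A_set \<alpha> j = {k. k \<ge> 1 \<and> j \<in> block \<alpha> k}"
proof -
  have a1: "real \<alpha> > 1" using assms by simp
  have "real k \<in> {1/2 + sqrt (1/4 + log \<alpha> ((real j + 1) / 2)) .. 1/2 + sqrt (1/4 + log \<alpha> j)}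
      \<longleftrightarrow> j \<in> block \<alpha> k" if k: "k \<ge> 1" for k
  proof -
    define u where "u = real k - 1/2"
    have u: "u > 0" using k by (simp add: u_def)
    have u2: "u\<^sup>2 = 1/4 + real (k * (k - 1))"
      using k by (simp add: u_def power2_eq_square algebra_simps of_nat_diff)
    have N: "real \<alpha> powr real (k * (k - 1)) = real (blen \<alpha> k)"
      using a1 by (subst powr_realpow) (auto simp: blen_def)
    have "1/2 + sqrt (1/4 + log \<alpha> ((real j + 1) / 2)) \<le> real k \<longleftrightarrow>
          sqrt (1/4 + log \<alpha> ((real j + 1) / 2)) \<le> sqrt (u\<^sup>2)"
      using u by (simp add: u_def) linarith
    also have "\<dots> \<longleftrightarrow> log \<alpha> ((real j + 1) / 2) \<le> real (k * (k - 1))"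
      unfolding u2 by simp
    also have "\<dots> \<longleftrightarrow> (real j + 1) / 2 \<le> real (blen \<alpha> k)"
      using a1 by (subst log_le_iff) (auto simp: N[symmetric])
    also have "\<dots> \<longleftrightarrow> j < 2 * blen \<alpha> k" by auto
    finally have 1: "1/2 + sqrt (1/4 + log \<alpha> ((real j + 1) / 2)) \<le> real k \<longleftrightarrow>
      j < 2 * blen \<alpha> k" .
    have "real k \<le> 1/2 + sqrt (1/4 + log \<alpha> j) \<longleftrightarrow> sqrt (u\<^sup>2) \<le> sqrt (1/4 + log \<alpha> j)"
      using u by (simp add: u_def) linarith
    also have "\<dots> \<longleftrightarrow> real (k * (k - 1)) \<le> log \<alpha> j"
      unfolding u2 by simp
    also have "\<dots> \<longleftrightarrow> real (blen \<alpha> k) \<le> real j"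
      using a1 assms by (subst le_log_iff) (auto simp: N[symmetric])
    finally show ?thesis using 1 by (auto simp: block_def)
  qed
  thus ?thesis by (auto simp: A_set_def)
qed

lemma block_pos: "\<alpha> > 1 \<Longrightarrow> j \<in> block \<alpha> k \<Longrightarrow> j \<ge> 1"
  using blen_pos[of \<alpha> k] by (auto simp: block_def)

lemma xseq_not_block:
  assumes "\<alpha> > 1" "j \<ge> 1" "\<And>k. k \<ge> 1 \<Longrightarrow> j \<notin> block \<alpha> k"
  shows "xseq p \<alpha> j = (\<lambda>m. 0)"
  using assms by (simp add: xseq_def A_set_eq)

section \<open>The terms as rows of Fourier matrices\<close>

text \<open>With \<open>N\<close> the block length, \<open>N powr (- 1 / p)\<close> normalizes a
  vector of \<open>N\<close> unimodular entries in the \<open>p\<close>-norm,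
  \<open>N powr (- 1 / 2)\<close> compensates for adding up to \<open>N\<close> orthogonal rows, and
  the power of \<open>\<alpha>\<close> makes the block contributions summable.\<close>

definition bcoeff :: "real \<Rightarrow> nat \<Rightarrow> nat \<Rightarrow> real" where
  "bcoeff p \<alpha> k = real (blen \<alpha> k) powr (- 1 / p - 1 / 2) * real \<alpha> powr (1 - real k)"

definition broot :: "nat \<Rightarrow> nat \<Rightarrow> nat \<Rightarrow> complex" where
  "broot \<alpha> k j = cis (2 * pi * (real j + 1) / real (blen \<alpha> k))"

lemma broot_power:
  assumes "\<alpha> > 1"
  shows "broot \<alpha> k j ^ blen \<alpha> k = 1"
proof -
  have "broot \<alpha> k j ^ blen \<alpha> k = cis (2 * pi * real (j + 1))"
    unfolding broot_def Complex.DeMoivre using blen_pos[OF assms, of k] by (simp add: add.commute)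
  also have "\<dots> = 1" by (rule cis_multiple_2pi) (simp only: Ints_of_nat)
  finally show ?thesis .
qed

lemma norm_broot [simp]: "norm (broot \<alpha> k j) = 1"
  by (simp add: broot_def)

text \<open>Shifting the block down to start at 0 removes a full turn, so up to a constant factor
  this is the standard enumeration of the roots of unity.\<close>

lemma inj_on_broot:
  assumes "\<alpha> > 1"
  shows "inj_on (broot \<alpha> k) (block \<alpha> k)"
proof (rule inj_onI)
  fix i j assume ij: "i \<in> block \<alpha> k" "j \<in> block \<alpha> k" and eq: "broot \<alpha> k i = broot \<alpha> k j"
  let ?N = "blen \<alpha> k"
  let ?e = "\<lambda>t. cis (2 * pi * real t / real ?N)"
  have N: "?N > 0" using blen_pos[OF assms] .
  have *: "broot \<alpha> k i = ?e (i - ?N) * cis (2 * pi / ?N)" if "i \<in> block \<alpha> k" for i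
  proof -
    have "?e (i - ?N) * cis (2 * pi / ?N) =
          cis (2 * pi * (real i + 1) / ?N - 2 * pi)"
      using that N by (simp add: cis_mult block_def field_simps)
    also have "\<dots> = broot \<alpha> k i" by (simp add: broot_def flip: cis_divide)
    finally show ?thesis ..
  qed
  have "?e (i - ?N) = ?e (j - ?N)"
    using eq by (simp add: *[OF ij(1)] *[OF ij(2)])
  moreover have "inj_on ?e {..<?N}"
    using Complex.bij_betw_roots_unity[OF N] by (rule bij_betw_imp_inj_on)
  moreover have "i - ?N \<in> {..<?N}" "j - ?N \<in> {..<?N}" using ij by (auto simp: block_def)
  ultimately have "i - ?N = j - ?N" by (blast dest: inj_onD)
  thus "i = j" using ij by (auto simp: block_def)
qed

lemma xseq_block:
  assumes "\<alpha> > 1" "p > 0" "k \<ge> 1" "j \<in> block \<alpha> k"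
  shows "xseq p \<alpha> j m =
    (if m \<in> block \<alpha> k
     then of_real (bcoeff p \<alpha> k) * broot \<alpha> k j ^ (m + 1 - blen \<alpha> k) else 0)"
proof -
  let ?N = "blen \<alpha> k"
  have N: "?N > 0" using blen_pos[OF assms(1)] .
  have j: "j \<ge> 1" using block_pos[OF assms(1,4)] .
  have A: "A_set \<alpha> j = {k}"
    using assms block_unique[OF assms(1)] by (auto simp: A_set_eq[OF assms(1) j])
  have pw: "real \<alpha> powr (real k * (real k - 1)) = real ?N"
    using assms(1,3) powr_realpow[of "real \<alpha>" "k * (k - 1)"] by (simp add: blen_def of_nat_diff)
  have pw': "real \<alpha> powr (real k * (1 - real k)) = 1 / real ?N"
  proof -
    have "real k * (1 - real k) = - (real k * (real k - 1))" by (simp add: algebra_simps)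
    thus ?thesis by (simp only: powr_minus pw) (simp add: divide_inverse)
  qed
  have c: "real \<alpha> powr ((1 - real k) * (real k * (2 + p) + 2 * p) / (2 * p)) = bcoeff p \<alpha> k"
  proof -
    have "(1 - real k) * (real k * (2 + p) + 2 * p) / (2 * p) =
        real k * (real k - 1) * (- 1 / p - 1 / 2) + (1 - real k)"
      using assms(2) by (simp add: field_simps)
    thus ?thesis by (simp only: bcoeff_def powr_add flip: powr_powr pw)
  qed
  \<comment> \<open>The summand -1 in the exponent only contributes \<open>s\<close> full turns, so
    it disappears.\<close>
  have e: "exp (complex_of_real (real j * (1 / real ?N) + 1 / real ?N - 1)
             * 2 * complex_of_real pi * of_nat s * \<i>) = broot \<alpha> k j ^ s" for s
  proof -
    have "exp (complex_of_real (real j * (1 / real ?N) + 1 / real ?N - 1)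
             * 2 * complex_of_real pi * of_nat s * \<i>) = 
          cis ((real j * (1 / real ?N) + 1 / real ?N - 1) * 2 * pi * real s)"
      by (simp add: cis_conv_exp mult_ac)
    also have "(real j * (1 / real ?N) + 1 / real ?N - 1) * 2 * pi * real s =
          real s * (2 * pi * (real j + 1) / real ?N) - 2 * pi * real s"
      by (simp add: add_divide_distrib algebra_simps)
    also have "cis \<dots> = broot \<alpha> k j ^ s"
      by (simp add: broot_def Complex.DeMoivre cis_multiple_2pi flip: cis_divide)
    finally show ?thesis .
  qed
  have sum: "(\<Sum>s=1..?N. f s * unit_vec (?N + s - 1) m) =
      (if m \<in> block \<alpha> k then f (m + 1 - ?N) else 0)" for f :: "nat \<Rightarrow> complex"
  proof -
    have "(\<Sum>s=1..?N. f s * unit_vec (?N + s - 1) m) =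
        (\<Sum>s=1..?N. if s = m + 1 - ?N then (if m \<in> block \<alpha> k then f s else 0) else 0)"
      by (intro sum.cong refl) (auto simp: unit_vec_def block_def)
    also have "\<dots> = (if m \<in> block \<alpha> k then f (m + 1 - ?N) else 0)"
      by (auto simp: block_def)
    finally show ?thesis .
  qed
  have "xseq p \<alpha> j m = of_real (bcoeff p \<alpha> k) *
      (\<Sum>s=1..?N. broot \<alpha> k j ^ s * unit_vec (?N + s - 1) m)"
    by (simp only: xseq_def A Let_def insert_not_empty if_False singleton_iff the_eq_trivial
        c pw' e flip: blen_def)
  thus ?thesis by (simp only: sum) simp
qed

section \<open>Sums over subfamilies\<close>

text \<open>Every term of index beyond \<open>2 * m\<close> vanishes at \<open>m\<close>, so this is the sum over all of \<open>F\<close>.\<close>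

definition psum :: "real \<Rightarrow> nat \<Rightarrow> nat set \<Rightarrow> nat \<Rightarrow> complex" where
  "psum p \<alpha> F m = (\<Sum>j\<in>F \<inter> {1..2 * m}. xseq p \<alpha> j m)"

lemma xseq_nonzeroD:
  assumes "\<alpha> > 1" "p > 0" "j \<ge> 1" "xseq p \<alpha> j m \<noteq> 0"
  shows "\<exists>k\<ge>1. j \<in> block \<alpha> k \<and> m \<in> block \<alpha> k"
proof -
  obtain k where k: "k \<ge> 1" "j \<in> block \<alpha> k"
    using xseq_not_block[OF assms(1,3)] assms(4) by metis
  with assms show ?thesis by (auto simp: xseq_block split: if_splits)
qed

text \<open>A nonzero entry puts \<open>j\<close> and \<open>m\<close> into a common block, where
  \<open>j < 2 * blen \<alpha> k \<le> 2 * m\<close>.\<close>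

lemma xseq_eq_0:
  assumes "\<alpha> > 1" "p > 0" "j \<ge> 1" "j \<notin> {1..2 * m}"
  shows "xseq p \<alpha> j m = 0"
proof (rule ccontr)
  assume "xseq p \<alpha> j m \<noteq> 0"
  then obtain k where "j \<in> block \<alpha> k" "m \<in> block \<alpha> k"
    using xseq_nonzeroD assms by blast
  with assms show False by (auto simp: block_def)
qed

lemma sum_xseq_eq_psum:
  assumes "\<alpha> > 1" "p > 0" "finite F" "F \<subseteq> {1..}"
  shows "(\<Sum>j\<in>F. xseq p \<alpha> j m) = psum p \<alpha> F m"
  unfolding psum_def using assms by (intro sum.mono_neutral_right) (auto intro!: xseq_eq_0)

lemma psum_not_block:
  assumes "\<alpha> > 1" "p > 0" "\<And>k. k \<ge> 1 \<Longrightarrow> m \<notin> block \<alpha> k"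
  shows "psum p \<alpha> F m = 0"
  unfolding psum_def
proof (intro sum.neutral ballI, rule ccontr)
  fix j assume "j \<in> F \<inter> {1..2 * m}" "xseq p \<alpha> j m \<noteq> 0"
  hence "\<exists>k\<ge>1. j \<in> block \<alpha> k \<and> m \<in> block \<alpha> k"
    by (intro xseq_nonzeroD[OF assms(1,2)]) auto
  with assms(3) show False by blast
qed

lemma psum_block:
  assumes "\<alpha> > 1" "p > 0" "k \<ge> 1" "m \<in> block \<alpha> k"
  shows "psum p \<alpha> F m = of_real (bcoeff p \<alpha> k) *
    (\<Sum>j\<in>F \<inter> block \<alpha> k. broot \<alpha> k j ^ (m + 1 - blen \<alpha> k))"
proof -
  have "psum p \<alpha> F m = (\<Sum>j\<in>F \<inter> block \<alpha> k. xseq p \<alpha> j m)"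
    unfolding psum_def
  proof (rule sum.mono_neutral_right)
    show "F \<inter> block \<alpha> k \<subseteq> F \<inter> {1..2 * m}"
      using assms(4) block_pos[OF assms(1)] by (fastforce simp: block_def)
    \<comment> \<open>A nonzero entry at \<open>m\<close> forces \<open>j\<close> into a block
      containing \<open>m\<close>, and that can only be block \<open>k\<close>.\<close>
    show "\<forall>j\<in>F \<inter> {1..2 * m} - F \<inter> block \<alpha> k. xseq p \<alpha> j m = 0"
      using xseq_nonzeroD[OF assms(1,2)] block_unique[OF assms(1,3) _ assms(4)] by fastforce
  qed simp
  also have "\<dots> = (\<Sum>j\<in>F \<inter> block \<alpha> k.
      of_real (bcoeff p \<alpha> k) * broot \<alpha> k j ^ (m + 1 - blen \<alpha> k))"
    using assms by (intro sum.cong) (auto simp: xseq_block)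
  finally show ?thesis by (simp add: sum_distrib_left)
qed

lemma sum_block_shift:
  fixes f :: "nat \<Rightarrow> real"
  shows "(\<Sum>m\<in>block \<alpha> k. f (m + 1 - blen \<alpha> k)) = (\<Sum>s=1..blen \<alpha> k. f s)"
  by (rule sum.reindex_bij_witness[of _ "\<lambda>s. s + blen \<alpha> k - 1" "\<lambda>m. m + 1 - blen \<alpha> k"])
     (auto simp: block_def)

lemma bcoeff_powr:
  assumes "\<alpha> > 1" "p > 0"
  shows "bcoeff p \<alpha> k powr p =
    real (blen \<alpha> k) powr (- 1 - p / 2) * real \<alpha> powr ((1 - real k) * p)"
proof -
  have "(- 1 / p - 1 / 2) * p = - 1 - p / 2"
    using assms by (simp add: field_simps)
  thus ?thesis by (simp add: bcoeff_def powr_mult powr_powr)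
qed

text \<open>The key estimate, uniform in \<open>F\<close>. Parseval bounds the sum of squares by
  \<open>N * N\<close> for block length \<open>N\<close>, so the power mean inequality yields
  \<open>N powr (1 + p / 2)\<close>. This cancels exactly against the power of \<open>N\<close> in
  \<open>bcoeff_powr\<close>.\<close>

lemma sum_block_psum_le:
  assumes "\<alpha> > 1" "1 \<le> p" "p \<le> 2" "k \<ge> 1"
  shows "(\<Sum>m\<in>block \<alpha> k. norm (psum p \<alpha> F m) powr p) \<le> 2 * (1 / 2) ^ k"
proof -
  let ?N = "blen \<alpha> k" and ?c = "bcoeff p \<alpha> k" and ?I = "F \<inter> block \<alpha> k"
  define g where "g s = norm (\<Sum>j\<in>?I. broot \<alpha> k j ^ s)" for s
  have N: "real ?N > 0" using blen_pos[OF assms(1)] by simp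
  have c: "?c \<ge> 0" by (simp add: bcoeff_def)
  have p: "p > 0" using assms(2) by simp
  have "(\<Sum>s=1..?N. (g s)\<^sup>2) = real ?N * real (card ?I)"
    unfolding g_def using inj_on_broot[OF assms(1)] N broot_power[OF assms(1)]
    by (intro parseval_roots_of_unity) (auto intro: inj_on_subset)
  also have "card ?I \<le> ?N"
    using card_mono[of "block \<alpha> k" ?I] by simp
  finally have "(\<Sum>s=1..?N. (g s)\<^sup>2) \<le> real (card {1..?N}) * real ?N"
    using N by simp
  hence "(\<Sum>s=1..?N. g s powr p) \<le> real (card {1..?N}) * real ?N powr (p / 2)"
    using assms p N by (intro sum_powr_le_of_sum_squares_le) (auto simp: g_def)
  hence g: "(\<Sum>s=1..?N. g s powr p) \<le> real ?N powr (1 + p / 2)"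
    using N by (simp add: powr_add)
  have "(\<Sum>m\<in>block \<alpha> k. norm (psum p \<alpha> F m) powr p) =
        (\<Sum>m\<in>block \<alpha> k. ?c powr p * g (m + 1 - ?N) powr p)"
    using assms(1,4) p c
    by (intro sum.cong refl) (simp add: psum_block norm_mult powr_mult g_def)
  also have "\<dots> = ?c powr p * (\<Sum>s=1..?N. g s powr p)"
    by (subst sum_block_shift) (simp add: sum_distrib_left)
  also have "\<dots> \<le> ?c powr p * real ?N powr (1 + p / 2)"
    using g by (intro mult_left_mono) auto
  also have "\<dots> = real \<alpha> powr ((1 - real k) * p)"
    using N by (simp add: bcoeff_powr[OF assms(1) p] flip: powr_add)
  \<comment> \<open>Here \<open>1 - k \<le> 0\<close> and \<open>p \<ge> 1\<close>; the same sign of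
    the exponent then allows replacing \<open>\<alpha>\<close> by 2.\<close>
  also have "\<dots> \<le> real \<alpha> powr (1 - real k)"
    using assms mult_left_mono[of 1 p "real k - 1"] by (intro powr_mono) (auto simp: algebra_simps)
  also have "\<dots> \<le> 2 powr (1 - real k)"
    using assms by (intro powr_mono2') auto
  also have "\<dots> = 2 * (1 / 2) ^ k"
    by (simp add: powr_diff powr_realpow power_one_over)
  finally show ?thesis .
qed

lemma sum_half_powers_le: "(\<Sum>k=K..M. (1 / 2 :: real) ^ k) \<le> 2 * (1 / 2) ^ K"
  by (simp add: sum_gp)

text \<open>Only blocks from index \<open>K\<close> on contribute, and their bounds form a geometric
  series.\<close>

lemma sum_psum_le:
  assumes "\<alpha> > 1" "1 \<le> p" "p \<le> 2" and F: "\<And>k. k < K \<Longrightarrow> F \<inter> block \<alpha> k = {}" and G: "finite G"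
  shows "(\<Sum>m\<in>G. norm (psum p \<alpha> F m) powr p) \<le> 4 * (1 / 2) ^ K"
proof -
  let ?f = "\<lambda>m. norm (psum p \<alpha> F m) powr p"
  have p: "p > 0" using assms(2) by simp
  obtain M where M: "\<And>m. m \<in> G \<Longrightarrow> m \<le> M"
    using G finite_nat_set_iff_bounded_le by auto
  \<comment> \<open>Coordinates up to \<open>M\<close> meet only blocks of index at most
    \<open>M\<close>. Index 0 is left out because it would count block 1 twice.\<close>
  define I where "I = {max 1 K..M}"
  have "m \<in> (\<Union>k\<in>I. block \<alpha> k)" if m: "m \<in> G" "?f m \<noteq> 0" for m
  proof -
    have nz: "psum p \<alpha> F m \<noteq> 0" using m(2) by auto
    then obtain k where k: "k \<ge> 1" "m \<in> block \<alpha> k"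
      using psum_not_block[OF assms(1) p] by metis
    have "F \<inter> block \<alpha> k \<noteq> {}"
      using psum_block[OF assms(1) p k, of F] nz by auto
    hence "k \<ge> K" using F by (meson not_le)
    moreover have "k \<le> M"
      using le_blen[OF assms(1), of k] k(2) M[OF m(1)] by (auto simp: block_def)
    ultimately show ?thesis using k by (auto simp: I_def)
  qed
  hence "(\<Sum>m\<in>G. ?f m) = (\<Sum>m\<in>G \<inter> (\<Union>k\<in>I. block \<alpha> k). ?f m)"
    by (intro sum.mono_neutral_right[OF G]) blast+
  also have "\<dots> \<le> (\<Sum>m\<in>(\<Union>k\<in>I. block \<alpha> k). ?f m)"
    by (intro sum_mono2) (auto simp: I_def)
  also have "\<dots> = (\<Sum>k\<in>I. \<Sum>m\<in>block \<alpha> k. ?f m)"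
    using block_unique[OF assms(1)] by (intro sum.UNION_disjoint) (auto simp: I_def)
  also have "\<dots> \<le> (\<Sum>k\<in>I. 2 * (1 / 2) ^ k)"
    using assms by (intro sum_mono sum_block_psum_le) (auto simp: I_def)
  also have "\<dots> \<le> 4 * (1 / 2) ^ max 1 K"
    using sum_half_powers_le[of "max 1 K" M] by (simp add: I_def flip: sum_distrib_left)
  also have "\<dots> \<le> 4 * (1 / 2) ^ K"
    by (intro mult_left_mono power_decreasing) auto
  finally show ?thesis .
qed

text \<open>The finite sums are bounded independently of the set of coordinates, which gives both
  summability and the bound on the infinite sum.\<close>

lemma
  assumes "\<alpha> > 1" "1 \<le> p" "p \<le> 2" "\<And>k. k < K \<Longrightarrow> F \<inter> block \<alpha> k = {}"
  shows psum_in_ellp: "psum p \<alpha> F \<in> ellp p"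
    and infsum_psum_le: "(\<Sum>\<^sub>\<infinity>m\<in>{1..}. norm (psum p \<alpha> F m) powr p) \<le> 4 * (1 / 2) ^ K"
proof -
  have summable: "(\<lambda>m. norm (psum p \<alpha> F m) powr p) summable_on {1..}"
    using sum_psum_le[OF assms]
    by (intro nonneg_bdd_above_summable_on bdd_aboveI2[where M = "4 * (1 / 2) ^ K"]) auto
  thus "psum p \<alpha> F \<in> ellp p"
    by (simp add: ellp_def psum_def)
  show "(\<Sum>\<^sub>\<infinity>m\<in>{1..}. norm (psum p \<alpha> F m) powr p) \<le> 4 * (1 / 2) ^ K"
    using sum_psum_le[OF assms] by (intro infsum_le_finite_sums[OF summable]) auto
qed

section \<open>Unconditional summability\<close>

lemma xseq_eq_psum:
  assumes "\<alpha> > 1" "p > 0" "j \<ge> 1"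
  shows "xseq p \<alpha> j = psum p \<alpha> {j}"
  by (intro ext) (use sum_xseq_eq_psum[OF assms(1,2), of "{j}"] assms(3) in simp)

text \<open>Writes the remainder of a partial sum as a sum over the complementary family, so that
  the estimates for families avoiding the first blocks apply to it.\<close>

lemma psum_diff_UNIV:
  assumes "\<alpha> > 1" "p > 0"
  shows "psum p \<alpha> F m - psum p \<alpha> UNIV m = - psum p \<alpha> (- F) m"
proof -
  have "psum p \<alpha> UNIV m = (\<Sum>j\<in>(F \<inter> {1..2 * m}) \<union> (- F \<inter> {1..2 * m}). xseq p \<alpha> j m)"
    unfolding psum_def by (rule sum.cong) auto
  also have "\<dots> = psum p \<alpha> F m + psum p \<alpha> (- F) m"
    unfolding psum_def by (intro sum.union_disjoint) auto
  finally show ?thesis by simp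
qed

lemma xseq_unconditionally_summable:
  assumes "\<alpha> > 1" "1 \<le> p" "p \<le> 2"
  shows "ellp_unconditionally_summable p (xseq p \<alpha>)"
  unfolding ellp_unconditionally_summable_def
\<comment> \<open>The limit stays schematic until the last step, where it becomes
  \<open>psum p \<alpha> UNIV\<close>, the same for all \<open>\<pi>\<close>.\<close>
proof (intro exI allI impI)
  fix \<pi> :: "nat \<Rightarrow> nat" assume \<pi>: "bij_betw \<pi> {1..} {1..}"
  have p: "p > 0" using assms(2) by simp
  have ge1: "\<pi> j \<ge> 1" if "j \<ge> 1" for j
    using \<pi> that by (auto dest: bij_betwE)
  \<comment> \<open>The \<open>p\<close>-th power of the norm of the remainder after
    \<open>n\<close> terms.\<close>
  define R where "R n = (\<Sum>\<^sub>\<infinity>m\<in>{1..}. norm (psum p \<alpha> (- \<pi> ` {1..n}) m) powr p)" for n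
  have norm_eq: "ellp_norm p (\<lambda>m. (\<Sum>j=1..n. xseq p \<alpha> (\<pi> j) m) - psum p \<alpha> UNIV m) =
      R n powr (1 / p)" for n
  proof -
    have "inj_on \<pi> {1..n}"
      using \<pi> by (auto simp: bij_betw_def intro: inj_on_subset)
    hence "(\<Sum>j=1..n. xseq p \<alpha> (\<pi> j) m) = (\<Sum>j\<in>\<pi> ` {1..n}. xseq p \<alpha> j m)" for m
      by (simp add: sum.reindex)
    moreover have "(\<Sum>j\<in>\<pi> ` {1..n}. xseq p \<alpha> j m) = psum p \<alpha> (\<pi> ` {1..n}) m" for m
      using ge1 by (intro sum_xseq_eq_psum[OF assms(1) p]) auto
    ultimately have "(\<Sum>j=1..n. xseq p \<alpha> (\<pi> j) m) = psum p \<alpha> (\<pi> ` {1..n}) m" for m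
      by simp
    thus ?thesis
      by (simp add: ellp_norm_def R_def psum_diff_UNIV[OF assms(1) p])
  qed
  have R_le: "R n \<le> 4 * (1 / 2) ^ K" if "{1..<2 * blen \<alpha> K} \<subseteq> \<pi> ` {1..n}" for n K
    unfolding R_def
  proof (rule infsum_psum_le[OF assms])
    fix k assume "k < K"
    hence "blen \<alpha> k \<le> blen \<alpha> K" by (intro blen_mono assms) auto
    hence "block \<alpha> k \<subseteq> {1..<2 * blen \<alpha> K}"
      using block_pos[OF assms(1)] by (force simp: block_def)
    thus "- \<pi> ` {1..n} \<inter> block \<alpha> k = {}"
      using that by blast
  qed
  have R_nonneg: "R n \<ge> 0" for n
    unfolding R_def by (intro infsum_nonneg) simp
  have "R \<longlonglongrightarrow> 0"
  proof (rule LIMSEQ_I)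
    fix r :: real assume "r > 0"
    hence "\<exists>K. (1 / 2) ^ K < r / 4" by (intro real_arch_pow_inv) auto
    then obtain K where K: "(1 / 2) ^ K < r / 4" ..
    \<comment> \<open>By surjectivity, the finitely many indices up to the end of block
      \<open>K\<close> all occur at positions in a finite set \<open>C\<close>, hence among the
      first \<open>n0\<close>.\<close>
    have "{1..<2 * blen \<alpha> K} \<subseteq> \<pi> ` {1..}"
      using \<pi> by (auto simp: bij_betw_def)
    then obtain C where C: "finite C" "C \<subseteq> {1..}" "{1..<2 * blen \<alpha> K} = \<pi> ` C"
      using finite_subset_image[OF finite_atLeastLessThan] by metis
    obtain n0 where n0: "C \<subseteq> {..n0}"
      using C(1) by (auto simp: finite_nat_iff_bounded_le)
    show "\<exists>n0. \<forall>n\<ge>n0. norm (R n - 0) < r"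
    proof (intro exI allI impI)
      fix n assume "n \<ge> n0"
      hence "{1..<2 * blen \<alpha> K} \<subseteq> \<pi> ` {1..n}"
        unfolding C(3) using C(2) n0 by (intro image_mono) force
      from R_le[OF this] K have "R n < r" by linarith
      thus "norm (R n - 0) < r" using R_nonneg[of n] by simp
    qed
  qed
  hence "(\<lambda>n. R n powr (1 / p)) \<longlonglongrightarrow> 0"
    using p R_nonneg by (intro tendsto_zero_powrI[OF _ tendsto_const]) auto
  \<comment> \<open>With \<open>K = 0\<close> the condition on the blocks is vacuous.\<close>
  moreover have ellp: "psum p \<alpha> F \<in> ellp p" for F
    by (rule psum_in_ellp[OF assms, of 0]) simp
  moreover have "xseq p \<alpha> (\<pi> j) \<in> ellp p" if "j \<ge> 1" for j
    using ellp ge1[OF that] by (simp add: xseq_eq_psum[OF assms(1) p])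
  ultimately show "ellp_sums p (\<lambda>j. xseq p \<alpha> (\<pi> j)) (psum p \<alpha> UNIV)"
    by (simp only: ellp_sums_def norm_eq) blast
qed

section \<open>Divergence of the series of norms\<close>

text \<open>All entries on the block have modulus \<open>bcoeff p \<alpha> k\<close>, and the factor
  \<open>N powr (1 / p)\<close> from counting the \<open>N\<close> entries cancels the one in
  \<open>bcoeff\<close>.\<close>

lemma ellp_norm_xseq:
  assumes "\<alpha> > 1" "p > 0" "k \<ge> 1" "j \<in> block \<alpha> k"
  shows "ellp_norm p (xseq p \<alpha> j) = real (blen \<alpha> k) powr (- 1 / 2) * real \<alpha> powr (1 - real k)"
proof -
  have N: "real (blen \<alpha> k) > 0" using blen_pos[OF assms(1)] by simp
  have c: "bcoeff p \<alpha> k \<ge> 0" by (simp add: bcoeff_def)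
  have "(\<Sum>\<^sub>\<infinity>m\<in>{1..}. norm (xseq p \<alpha> j m) powr p) = (\<Sum>\<^sub>\<infinity>m\<in>block \<alpha> k. bcoeff p \<alpha> k powr p)"
    using assms c block_pos[OF assms(1)]
    by (intro infsum_cong_neutral) (auto simp: xseq_block norm_mult norm_power)
  also have "\<dots> = real (blen \<alpha> k) * bcoeff p \<alpha> k powr p"
    by simp
  finally have "ellp_norm p (xseq p \<alpha> j) = real (blen \<alpha> k) powr (1 / p) * bcoeff p \<alpha> k"
    using assms(2) c by (simp add: ellp_norm_def powr_mult powr_powr)
  also have "\<dots> = real (blen \<alpha> k) powr (1 / p + (- 1 / p - 1 / 2)) * real \<alpha> powr (1 - real k)"
    by (simp only: bcoeff_def powr_add mult.assoc)
  also have "1 / p + (- 1 / p - 1 / 2) = - 1 / 2" by simp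
  finally show ?thesis .
qed

text \<open>A block of length \<open>N\<close> has \<open>N\<close> terms of equal norm;
  substituting \<open>N = \<alpha> powr (k * (k - 1))\<close> collects everything into one exponent,
  quadratic in \<open>k\<close> with leading coefficient \<open>\<epsilon> / 2\<close>.\<close>

lemma block_sum_norms:
  assumes "\<alpha> > 1" "p > 0" "k \<ge> 1"
  shows "(\<Sum>j\<in>block \<alpha> k. ellp_norm p (xseq p \<alpha> j) powr (2 - \<epsilon>)) =
    real \<alpha> powr ((real k - 1) * (real k * \<epsilon> / 2 + \<epsilon> - 2))"
proof -
  have N: "real (blen \<alpha> k) = real \<alpha> powr (real k * (real k - 1))"
    using assms(1,3) powr_realpow[of "real \<alpha>" "k * (k - 1)"] by (simp add: blen_def of_nat_diff)
  have "(\<Sum>j\<in>block \<alpha> k. ellp_norm p (xseq p \<alpha> j) powr (2 - \<epsilon>)) =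
    real (blen \<alpha> k) * (real (blen \<alpha> k) powr (- 1 / 2) * real \<alpha> powr (1 - real k)) powr (2 - \<epsilon>)"
    by (simp add: ellp_norm_xseq[OF assms])
  also have "\<dots> = real \<alpha> powr (real k * (real k - 1)
      + (real k * (real k - 1) * (- 1 / 2) + (1 - real k)) * (2 - \<epsilon>))"
    unfolding N by (simp only: powr_powr flip: powr_add)
  also have "real k * (real k - 1) + (real k * (real k - 1) * (- 1 / 2) + (1 - real k)) * (2 - \<epsilon>)
      = (real k - 1) * (real k * \<epsilon> / 2 + \<epsilon> - 2)"
    by (simp add: field_simps)
  finally show ?thesis .
qed

text \<open>Each block sum bounds the whole series from below, and these sums are unbounded. As
  \<open>0 powr x = 0\<close>, vanishing terms contribute 0 also for
  \<open>\<epsilon> \<ge> 2\<close>.\<close>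

lemma infsum_norms_xseq:
  assumes "\<alpha> > 1" "p > 0" "\<epsilon> > 0"
  shows "(\<Sum>\<^sub>\<infinity>j\<in>{1..}. ennreal (ellp_norm p (xseq p \<alpha> j) powr (2 - \<epsilon>))) = \<infinity>"
proof -
  let ?S = "\<Sum>\<^sub>\<infinity>j\<in>{1..}. ennreal (ellp_norm p (xseq p \<alpha> j) powr (2 - \<epsilon>))"
  let ?h = "\<lambda>k. real \<alpha> powr ((real k - 1) * (real k * \<epsilon> / 2 + \<epsilon> - 2))"
  have le: "ennreal (?h k) \<le> ?S" if "k \<ge> 1" for k
  proof -
    have "ennreal (?h k) = (\<Sum>j\<in>block \<alpha> k. ennreal (ellp_norm p (xseq p \<alpha> j) powr (2 - \<epsilon>)))"
      by (simp add: block_sum_norms[OF assms(1,2) that, symmetric])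
    also have "\<dots> = (\<Sum>\<^sub>\<infinity>j\<in>block \<alpha> k. ennreal (ellp_norm p (xseq p \<alpha> j) powr (2 - \<epsilon>)))"
      by simp
    also have "\<dots> \<le> ?S"
      using block_pos[OF assms(1)]
      by (intro infsum_mono_neutral nonneg_summable_on_complete) auto
    finally show ?thesis .
  qed
  have "filterlim ?h at_top sequentially"
    using assms by real_asymp
  show ?thesis
  proof (rule ccontr)
    assume "?S \<noteq> \<infinity>"
    then obtain B where B: "B \<ge> 0" "?S = ennreal B"
      by (cases ?S) auto
    have "eventually (\<lambda>k. ?h k > B \<and> k \<ge> 1) sequentially"
      using \<open>filterlim ?h at_top sequentially\<close>
      by (intro eventually_conj eventually_ge_at_top) (simp add: filterlim_at_top_dense)
    then obtain k where "?h k > B" "k \<ge> 1"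
      using eventually_happens'[OF sequentially_bot] by blast
    with le[of k] B show False by simp
  qed
qed

theorem theorem2p1:
  fixes p :: real and \<alpha> :: nat
  assumes "p \<in> {1..2}" and "\<alpha> > 1"
  shows "(\<forall>j\<ge>1. \<exists>\<^sub>\<le>\<^sub>1 k. k \<in> A_set \<alpha> j) \<and>
    ellp_unconditionally_summable p (xseq p \<alpha>) \<and>
    (\<forall>\<epsilon>::real. \<epsilon> > 0 \<longrightarrow>
      (\<Sum>\<^sub>\<infinity>j\<in>{1..}. ennreal (ellp_norm p (xseq p \<alpha> j) powr (2 - \<epsilon>))) = \<infinity>)"
proof (intro conjI allI impI)
  fix j :: nat assume "j \<ge> 1"
  thus "\<exists>\<^sub>\<le>\<^sub>1 k. k \<in> A_set \<alpha> j"
    using block_unique[OF assms(2)] by (auto simp: A_set_eq[OF assms(2)] Uniq_def)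
next
  show "ellp_unconditionally_summable p (xseq p \<alpha>)"
    using assms by (intro xseq_unconditionally_summable) auto
next
  fix \<epsilon> :: real assume "\<epsilon> > 0"
  thus "(\<Sum>\<^sub>\<infinity>j\<in>{1..}. ennreal (ellp_norm p (xseq p \<alpha> j) powr (2 - \<epsilon>))) = \<infinity>"
    using assms by (intro infsum_norms_xseq) auto
qed

end
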